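(* Let $\mathscr{T} \subset \mathscr{L}(E)$ be a bounded abelian multiplicative semigroup of operators on a hereditarily indecomposable (HI) Banach space $E$. Then either $\mathscr{N}(\mathscr{T})$ or $\mathscr{R}(\mathscr{T})$ is finite-dimensional.
   Context: Banach spaces are real or complex; semigroups are non-empty. $\mathscr{L}(E)$ is the algebra of bounded linear operators on $E$; "bounded" means $\sup_{T\in\mathscr{T}}\|T\|<\infty$. $\mathscr{N}(\mathscr{T})$ and $\mathscr{R}(\mathscr{T})$ denote, respectively, the intersection of the kernels and the closed linear span of the ranges of all operators $T - I$, $T\in\mathscr{T}$, where $I$ is the identity operator on $E$. A Banach space $X$ is hereditarily indecomposable (HI) if for every projection (bounded linear operator that is the identity on its range $Z$) $P : Y \to Z$, where $Z \subset Y \subset X$ are closed linear subspaces, the kernel or the range of $P$ is finite-dimensional. "Either ... or" means at least one. *)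

theory Defs
  imports "HOL-Analysis.Analysis"
begin

text \<open>
  A normed space over a scalar field given by an explicit scalar multiplication, since
  the class \<open>banach\<close> knows real scalars only. A field in the class \<open>real_normed_field\<close> has a
  multiplicative norm extending the absolute value of the reals, so by the Gelfand--Mazur theorem
  it is, up to isometric isomorphism, the field of real or of complex numbers.
  The assumption \<open>scale_of_real\<close> makes the structure compatible with the real one of the type;
  for real scalars it forces \<open>scale = scaleR\<close>. Spans, subspaces, dimensions and linearity below
  always refer to \<open>scale\<close>.
\<close>

locale normed_space_over = vector_space scale
  for scale :: "'k::real_normed_field \<Rightarrow> 'a::real_normed_vector \<Rightarrow> 'a" +
  assumes scale_of_real: "scale (of_real r) x = r *\<^sub>R x"
    and norm_scale: "norm (scale c x) = norm c * norm x"
begin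

definition finite_dimensional :: "'a set \<Rightarrow> bool" where
  "finite_dimensional S \<longleftrightarrow> (\<exists>B. finite B \<and> span B = S)"

text \<open>\<open>P\<close> is a total function on the type, but only its values on \<open>Y\<close> matter.\<close>

definition projection :: "'a set \<Rightarrow> 'a set \<Rightarrow> ('a \<Rightarrow> 'a) \<Rightarrow> bool" where
  "projection Y Z P \<longleftrightarrow>
     (\<forall>x\<in>Y. \<forall>y\<in>Y. P (x + y) = P x + P y) \<and>
     (\<forall>c. \<forall>x\<in>Y. P (scale c x) = scale c (P x)) \<and>
     (\<exists>K. \<forall>x\<in>Y. norm (P x) \<le> K * norm x) \<and>
     P ` Y = Z \<and> (\<forall>z\<in>Z. P z = z)"

definition hereditarily_indecomposable :: bool where
  "hereditarily_indecomposable \<longleftrightarrow>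
     (\<forall>Y Z P. subspace Y \<and> closed Y \<and> subspace Z \<and> closed Z \<and> Z \<subseteq> Y \<and> projection Y Z P \<longrightarrow>
        finite_dimensional {y \<in> Y. P y = 0} \<or> finite_dimensional Z)"

text \<open>An element of the library type of bounded operators is only real-linear.\<close>

definition bounded_operators :: "('a \<Rightarrow>\<^sub>L 'a) set" where
  "bounded_operators = {T. \<forall>c x. blinfun_apply T (scale c x) = scale c (blinfun_apply T x)}"

definition closed_range_span :: "('a \<Rightarrow>\<^sub>L 'a) set \<Rightarrow> 'a set" where
  "closed_range_span \<T> = closure (span (\<Union>T\<in>\<T>. range (blinfun_apply (T - id_blinfun))))"

end

lemma normed_space_over_real: "normed_space_over (scaleR :: real \<Rightarrow> 'a::real_normed_vector \<Rightarrow> 'a)"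
  by unfold_locales (simp_all add: scaleR_add_right scaleR_add_left)

lemma normed_space_over_complex: "normed_space_over ((*) :: complex \<Rightarrow> complex \<Rightarrow> complex)"
  by unfold_locales (simp_all add: algebra_simps scaleR_conv_of_real norm_mult)

definition abelian_semigroup :: "('a::real_normed_vector \<Rightarrow>\<^sub>L 'a) set \<Rightarrow> bool" where
  "abelian_semigroup \<T> \<longleftrightarrow> \<T> \<noteq> {} \<and>
     (\<forall>S\<in>\<T>. \<forall>T\<in>\<T>. S o\<^sub>L T \<in> \<T> \<and> S o\<^sub>L T = T o\<^sub>L S)"

definition common_kernel :: "('a::real_normed_vector \<Rightarrow>\<^sub>L 'a) set \<Rightarrow> 'a set" where
  "common_kernel \<T> = {x. \<forall>T\<in>\<T>. blinfun_apply (T - id_blinfun) x = 0}"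

end

theory Submission
  imports Defs
begin

text \<open>
  Let \<open>N\<close> be the common kernel and \<open>R\<close> the closed span of the ranges of the \<open>T - I\<close>. The
  convex hull \<open>C\<close> of \<open>\<T>\<close> is again a bounded abelian semigroup, say with bound \<open>M\<close>, and all its
  members fix \<open>N\<close> pointwise. In contrast, the vectors of \<open>R\<close> can be made arbitrarily small by
  members of \<open>C\<close>: the Cesaro means \<open>A\<^sub>n = (T + \<dots> + T\<^sup>n) / n\<close> satisfy
  \<open>A\<^sub>n (T - I) x = (T\<^sup>n\<^sup>+\<^sup>1 x - T x) / n\<close>, which tends to \<open>0\<close>, and the vectors that \<open>C\<close> makes
  arbitrarily small form a closed subspace (\<open>vanishing_set_contains_closed_range_span\<close>). If \<open>A\<close> in
  \<open>C\<close> makes \<open>y\<close> in \<open>R\<close> small, then for \<open>x\<close> in \<open>N\<close> the vector \<open>x = A x = A (x + y) - A y\<close> has a norm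
  of at most \<open>M \<parallel>x + y\<parallel>\<close> plus an arbitrarily small amount. Hence \<open>\<parallel>x\<parallel> \<le> M \<parallel>x + y\<parallel>\<close>,
  which makes \<open>N + R\<close> a closed direct sum with a bounded projection onto \<open>N\<close> along \<open>R\<close>. A hereditarily
  indecomposable space admits such a projection only if its range \<open>N\<close> or its kernel \<open>R\<close> is
  finite-dimensional (\<open>hereditarily_indecomposable_summands\<close>).
\<close>

section \<open>Direct sums in hereditarily indecomposable spaces\<close>

lemma complete_Times:
  fixes S :: "'a::metric_space set" and T :: "'b::metric_space set"
  assumes "complete S" "complete T"
  shows "complete (S \<times> T)"
  unfolding complete_def
proof (intro allI impI, elim conjE)
  fix f assume f: "\<forall>n. f n \<in> S \<times> T" "Cauchy f"
  have "\<forall>n. fst (f n) \<in> S" "\<forall>n. snd (f n) \<in> T"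
    using f(1) by (metis mem_Times_iff)+
  then obtain a b where "a \<in> S" "(\<lambda>n. fst (f n)) \<longlonglongrightarrow> a" "b \<in> T" "(\<lambda>n. snd (f n)) \<longlonglongrightarrow> b"
    using assms Cauchy_fst[OF f(2)] Cauchy_snd[OF f(2)] by (metis completeE)
  then show "\<exists>l\<in>S \<times> T. f \<longlonglongrightarrow> l"
    using tendsto_Pair[of "\<lambda>n. fst (f n)" a sequentially "\<lambda>n. snd (f n)" b] by force
qed

context normed_space_over
begin

lemma scale_scaleR_commute: "scale c (r *\<^sub>R x) = r *\<^sub>R scale c x"
  by (metis scale_left_commute scale_of_real)

lemma bounded_linear_scale: "bounded_linear (scale c)"
  by (rule bounded_linear_intro[where K = "norm c"])
     (simp_all add: scale_right_distrib scale_scaleR_commute norm_scale)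

lemma subspace_imp_real_subspace: "subspace S \<Longrightarrow> Real_Vector_Spaces.subspace S"
  unfolding Real_Vector_Spaces.subspace_def using subspace_0 subspace_add subspace_scale
  by (metis scale_of_real)

lemma subspace_closure:
  assumes "subspace S"
  shows "subspace (closure S)"
proof (rule subspaceI)
  show "0 \<in> closure S"
    using subspace_0[OF assms] closure_subset by blast
next
  fix x y assume "x \<in> closure S" "y \<in> closure S"
  then obtain a b where "\<And>n. a n \<in> S" "a \<longlonglongrightarrow> x" "\<And>n. b n \<in> S" "b \<longlonglongrightarrow> y"
    unfolding closure_sequential by blast
  then have "(\<lambda>n. a n + b n) \<longlonglongrightarrow> x + y" "\<And>n. a n + b n \<in> S"
    using subspace_add[OF assms] by (auto intro: tendsto_add)
  then show "x + y \<in> closure S"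
    unfolding closure_sequential by (intro exI[of _ "\<lambda>n. a n + b n"]) simp
next
  fix c x assume "x \<in> closure S"
  moreover have "scale c ` S \<subseteq> S"
    using subspace_scale[OF assms] by blast
  ultimately show "scale c x \<in> closure S"
    using closure_bounded_linear_image_subset[OF bounded_linear_scale, of c S] closure_mono by blast
qed

text \<open>
  The inequality makes \<open>(x, y) \<mapsto> x + y\<close> bounded below on \<open>N \<times> R\<close>, so the sum inherits completeness
  from the product.
\<close>

lemma complete_sum_of_subspaces:
  assumes "subspace N" "subspace R" "complete N" "complete R"
    and "K \<ge> 0" and bound: "\<And>x y. x \<in> N \<Longrightarrow> y \<in> R \<Longrightarrow> norm x \<le> K * norm (x + y)"
  shows "complete {x + y |x y. x \<in> N \<and> y \<in> R}"
proof -
  have pos: "0 < 1 / (2 * K + 1)"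
    using \<open>K \<ge> 0\<close> by simp
  have "Real_Vector_Spaces.subspace (N \<times> R)"
    using assms by (intro subspace_Times subspace_imp_real_subspace)
  moreover have "bounded_linear (\<lambda>p. fst p + snd p)"
    by (intro bounded_linear_add bounded_linear_fst bounded_linear_snd)
  moreover have "\<forall>p\<in>N \<times> R. 1 / (2 * K + 1) * norm p \<le> norm (fst p + snd p)"
  proof clarsimp
    fix x y assume xy: "x \<in> N" "y \<in> R"
    have "norm (x, y) \<le> norm x + norm y"
      by (rule norm_Pair_le)
    also have "norm y \<le> norm x + norm (x + y)"
      by (metis add_diff_cancel_left' norm_triangle_ineq4 add.commute)
    finally have "norm (x, y) \<le> (2 * K + 1) * norm (x + y)"
      using bound[OF xy] by (simp add: algebra_simps)
    then show "norm (x, y) / (2 * K + 1) \<le> norm (x + y)"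
      using \<open>K \<ge> 0\<close> by (simp add: field_simps)
  qed
  moreover have "complete (N \<times> R)"
    using assms by (intro complete_Times)
  ultimately have "complete ((\<lambda>p. fst p + snd p) ` (N \<times> R))"
    by (rule complete_isometric_image[OF pos])
  moreover have "(\<lambda>p. fst p + snd p) ` (N \<times> R) = {x + y |x y. x \<in> N \<and> y \<in> R}"
    by (force simp: image_iff)
  ultimately show ?thesis
    by simp
qed

text \<open>
  The bound also yields uniqueness of the decomposition: if \<open>x + y = 0\<close>, then \<open>x = 0\<close>. So
  the component in \<open>N\<close> is a well-defined projection with norm at most \<open>K\<close> and kernel \<open>R\<close>.
\<close>

lemma hereditarily_indecomposable_summands:
  assumes hi: "hereditarily_indecomposable"
    and sub: "subspace N" "subspace R" and compl: "complete N" "complete R"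
    and "K \<ge> 0" and bound: "\<And>x y. x \<in> N \<Longrightarrow> y \<in> R \<Longrightarrow> norm x \<le> K * norm (x + y)"
  shows "finite_dimensional N \<or> finite_dimensional R"
proof -
  define Y where "Y = {x + y |x y. x \<in> N \<and> y \<in> R}"
  define P where "P w = (SOME x. x \<in> N \<and> w - x \<in> R)" for w
  have P: "P (x + y) = x" if xy: "x \<in> N" "y \<in> R" for x y
    unfolding P_def
  proof (rule some_equality)
    fix x' assume x': "x' \<in> N \<and> x + y - x' \<in> R"
    then have "x' - x \<in> N" "(x + y - x') - y \<in> R"
      using xy subspace_diff[OF sub(1)] subspace_diff[OF sub(2)] by blast+
    from bound[OF this] show "x' = x"
      by simp
  qed (use xy in simp)
  have "subspace Y"
    unfolding Y_def by (rule subspace_sums[OF sub])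
  moreover have "closed Y"
    unfolding Y_def by (rule complete_imp_closed[OF complete_sum_of_subspaces]) (use assms in auto)
  moreover have N: "N \<subseteq> Y" "\<And>z. z \<in> N \<Longrightarrow> P z = z"
    using subspace_0[OF sub(2)] P[of _ 0] by (force simp: Y_def)+
  moreover have "projection Y N P"
    unfolding projection_def
  proof (intro conjI ballI allI)
    fix w w' assume "w \<in> Y" "w' \<in> Y"
    then obtain x y x' y' where *: "w = x + y" "w' = x' + y'" "x \<in> N" "y \<in> R" "x' \<in> N" "y' \<in> R"
      unfolding Y_def by blast
    then have "w + w' = (x + x') + (y + y')"
      by simp
    then show "P (w + w') = P w + P w'"
      using * P sub by (metis subspace_add)
  next
    fix c w assume "w \<in> Y"
    then obtain x y where *: "w = x + y" "x \<in> N" "y \<in> R"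
      unfolding Y_def by blast
    then have "scale c w = scale c x + scale c y"
      by (simp add: scale_right_distrib)
    then show "P (scale c w) = scale c (P w)"
      using * P sub by (metis subspace_scale)
  next
    show "\<exists>K. \<forall>w\<in>Y. norm (P w) \<le> K * norm w"
      using bound P unfolding Y_def by (intro exI[of _ K]) auto
  next
    show "P ` Y = N"
      using N P unfolding Y_def by force
  qed (use N in auto)
  ultimately have "finite_dimensional {w \<in> Y. P w = 0} \<or> finite_dimensional N"
    using hi sub(1) complete_imp_closed[OF compl(1)] unfolding hereditarily_indecomposable_def by blast
  moreover have "{w \<in> Y. P w = 0} = R"
    using P[OF subspace_0[OF sub(1)]] subspace_0[OF sub(1)] P unfolding Y_def by force
  ultimately show ?thesis
    by auto
qed

end

section \<open>The convex hull of an operator semigroup\<close>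

text \<open>
  Composition is bilinear, so for each fixed factor the condition on the other one is convex and
  passes from \<open>\<T>\<close> to its hull. The two factors are treated one after the other, in this
  lemma and in the next one.
\<close>

lemma convex_hull_commute:
  assumes "\<And>S T. S \<in> \<T> \<Longrightarrow> T \<in> \<T> \<Longrightarrow> S o\<^sub>L T = T o\<^sub>L S"
    and "A \<in> convex hull \<T>" "B \<in> convex hull \<T>"
  shows "A o\<^sub>L B = B o\<^sub>L A"
proof -
  have convex: "convex {A. A o\<^sub>L B = B o\<^sub>L A}" for B :: "'a \<Rightarrow>\<^sub>L 'a"
    by (auto intro!: convexI simp: bounded_bilinear.add_left[OF bounded_bilinear_blinfun_compose]
        bounded_bilinear.add_right[OF bounded_bilinear_blinfun_compose]
        bounded_bilinear.scaleR_left[OF bounded_bilinear_blinfun_compose]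
        bounded_bilinear.scaleR_right[OF bounded_bilinear_blinfun_compose])
  have "convex hull \<T> \<subseteq> {A. A o\<^sub>L T = T o\<^sub>L A}" if "T \<in> \<T>" for T
    using assms(1) that by (intro hull_minimal convex) auto
  then have "convex hull \<T> \<subseteq> {B. B o\<^sub>L A = A o\<^sub>L B}"
    using assms(2) by (intro hull_minimal convex) force
  then show ?thesis
    using assms(3) by auto
qed

lemma convex_hull_compose:
  assumes "\<And>S T. S \<in> \<T> \<Longrightarrow> T \<in> \<T> \<Longrightarrow> S o\<^sub>L T \<in> \<T>"
    and "A \<in> convex hull \<T>" "B \<in> convex hull \<T>"
  shows "A o\<^sub>L B \<in> convex hull \<T>"
proof -
  have left: "convex {A. A o\<^sub>L B \<in> convex hull \<T>}" for B
    by (auto intro!: convexI convexD[OF convex_convex_hull]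
        simp: bounded_bilinear.add_left[OF bounded_bilinear_blinfun_compose]
        bounded_bilinear.scaleR_left[OF bounded_bilinear_blinfun_compose])
  have right: "convex {B. A o\<^sub>L B \<in> convex hull \<T>}" for A
    by (auto intro!: convexI convexD[OF convex_convex_hull]
        simp: bounded_bilinear.add_right[OF bounded_bilinear_blinfun_compose]
        bounded_bilinear.scaleR_right[OF bounded_bilinear_blinfun_compose])
  have "convex hull \<T> \<subseteq> {A. A o\<^sub>L T \<in> convex hull \<T>}" if "T \<in> \<T>" for T
    using assms(1) that by (intro hull_minimal left) (auto intro: hull_inc)
  then have "convex hull \<T> \<subseteq> {B. A o\<^sub>L B \<in> convex hull \<T>}"
    using assms(2) by (intro hull_minimal right) auto
  then show ?thesis
    using assms(3) by auto
qed

lemma convex_hull_fixes_common_kernel: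
  assumes "A \<in> convex hull \<T>" "x \<in> common_kernel \<T>"
  shows "A x = x"
proof -
  have "convex {A. blinfun_apply A x = x}"
    by (auto intro!: convexI simp: blinfun.bilinear_simps simp flip: scaleR_add_left)
  then have "convex hull \<T> \<subseteq> {A. blinfun_apply A x = x}"
    using assms(2) by (intro hull_minimal) (auto simp: common_kernel_def blinfun.bilinear_simps)
  then show ?thesis
    using assms(1) by auto
qed

lemma (in normed_space_over) convex_bounded_operators: "convex bounded_operators"
  by (auto intro!: convexI simp: bounded_operators_def blinfun.bilinear_simps
      scale_right_distrib scale_scaleR_commute)

section \<open>Vectors made arbitrarily small by averaging\<close>

definition vanishing_set :: "('a::real_normed_vector \<Rightarrow>\<^sub>L 'a) set \<Rightarrow> 'a set" where
  "vanishing_set \<C> = {y. \<forall>e>0. \<exists>A\<in>\<C>. norm (A y) < e}"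

lemma norm_blinfun_apply_le:
  assumes "norm A \<le> M"
  shows "norm (blinfun_apply A x) \<le> M * norm x"
  using norm_blinfun[of A x] mult_right_mono[OF assms, of "norm x"] by auto

text \<open>
  The uniform bound \<open>M\<close> lets an operator that is small at a nearby vector serve for the limit too.
\<close>

lemma closed_vanishing_set:
  assumes M: "M > 0" "\<And>A. A \<in> \<C> \<Longrightarrow> norm A \<le> M"
  shows "closed (vanishing_set \<C>)"
proof -
  have "y \<in> vanishing_set \<C>" if y: "y \<in> closure (vanishing_set \<C>)" for y
    unfolding vanishing_set_def
  proof clarify
    fix e :: real assume "e > 0"
    then have pos: "e / 2 > 0" "e / (2 * M) > 0"
      using M by auto
    then obtain z where z: "z \<in> vanishing_set \<C>" "dist z y < e / (2 * M)"
      using y by (meson closure_approachable)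
    then obtain A where A: "A \<in> \<C>" "norm (A z) < e / 2"
      using pos unfolding vanishing_set_def by blast
    have "norm (A (y - z)) \<le> M * norm (y - z)"
      using A M by (intro norm_blinfun_apply_le) auto
    also have "\<dots> < e / 2"
      using z M by (simp add: dist_norm norm_minus_commute field_simps)
    finally have "norm (A z) + norm (A (y - z)) < e"
      using A by simp
    moreover have "A y = A z + A (y - z)"
      by (simp add: blinfun.bilinear_simps)
    ultimately show "\<exists>A\<in>\<C>. norm (A y) < e"
      using A norm_triangle_ineq[of "A z" "A (y - z)"] by (intro bexI[of _ A]) auto
  qed
  then show ?thesis
    by (simp add: closure_subset_eq[symmetric] subsetI)
qed

text \<open>
  For the sum of two vectors, the product of two operators serves: each factor can be
  applied first because they commute, and the other one increases norms by at most a
  factor \<open>M\<close>.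
\<close>

lemma (in normed_space_over) subspace_vanishing_set:
  assumes "\<C> \<noteq> {}" "\<C> \<subseteq> bounded_operators"
    and compose: "\<And>A B. A \<in> \<C> \<Longrightarrow> B \<in> \<C> \<Longrightarrow> A o\<^sub>L B \<in> \<C>"
    and commute: "\<And>A B. A \<in> \<C> \<Longrightarrow> B \<in> \<C> \<Longrightarrow> A o\<^sub>L B = B o\<^sub>L A"
    and M: "M > 0" "\<And>A. A \<in> \<C> \<Longrightarrow> norm A \<le> M"
  shows "subspace (vanishing_set \<C>)"
proof (rule subspaceI)
  show "0 \<in> vanishing_set \<C>"
    using assms(1) by (auto simp: vanishing_set_def blinfun.bilinear_simps)
next
  fix y z assume yz: "y \<in> vanishing_set \<C>" "z \<in> vanishing_set \<C>"
  show "y + z \<in> vanishing_set \<C>"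
    unfolding vanishing_set_def
  proof clarify
    fix e :: real assume "e > 0"
    then have "e / (2 * M) > 0"
      using M by auto
    then obtain A B where A: "A \<in> \<C>" "norm (A y) < e / (2 * M)" and B: "B \<in> \<C>" "norm (B z) < e / (2 * M)"
      using yz unfolding vanishing_set_def by blast
    have "norm (B (A y)) \<le> M * norm (A y)" "norm (A (B z)) \<le> M * norm (B z)"
      using A B M by (auto intro!: norm_blinfun_apply_le)
    moreover have "M * norm (A y) < e / 2" "M * norm (B z) < e / 2"
      using A B M by (auto simp: field_simps)
    moreover have "(A o\<^sub>L B) (y + z) = B (A y) + A (B z)"
      using commute[OF A(1) B(1)]
      by (metis blinfun.add_right blinfun_apply_blinfun_compose)
    ultimately have "norm ((A o\<^sub>L B) (y + z)) < e"
      using norm_triangle_ineq[of "B (A y)" "A (B z)"] by simp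
    then show "\<exists>A\<in>\<C>. norm (A (y + z)) < e"
      using compose[OF A(1) B(1)] by blast
  qed
next
  fix c y assume y: "y \<in> vanishing_set \<C>"
  show "scale c y \<in> vanishing_set \<C>"
    unfolding vanishing_set_def
  proof clarify
    fix e :: real assume "e > 0"
    then have "e / (norm c + 1) > 0"
      by (simp add: add_nonneg_pos)
    then obtain A where A: "A \<in> \<C>" "norm (A y) < e / (norm c + 1)"
      using y unfolding vanishing_set_def by blast
    have "norm (A (scale c y)) = norm c * norm (A y)"
      using A(1) assms(2) by (auto simp: bounded_operators_def norm_scale)
    also have "\<dots> \<le> (norm c + 1) * norm (A y)"
      by (simp add: mult_right_mono)
    also have "\<dots> < e"
      using A(2) by (simp add: pos_less_divide_eq add_nonneg_pos mult.commute)
    finally show "\<exists>A\<in>\<C>. norm (A (scale c y)) < e"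
      using A(1) by blast
  qed
qed

text \<open>
  The Cesaro means of the powers of \<open>T\<close> lie in the convex hull, and their values at \<open>T x - x\<close>
  telescope to a bounded vector divided by the number of terms.
\<close>

lemma vanishing_set_contains_range:
  assumes compose: "\<And>S T. S \<in> \<T> \<Longrightarrow> T \<in> \<T> \<Longrightarrow> S o\<^sub>L T \<in> \<T>"
    and M: "M > 0" "\<And>A. A \<in> \<T> \<Longrightarrow> norm A \<le> M" and T: "T \<in> \<T>"
  shows "(T - id_blinfun) x \<in> vanishing_set (convex hull \<T>)"
  unfolding vanishing_set_def
proof clarify
  fix e :: real assume "e > 0"
  \<comment> \<open>\<open>U k\<close> is \<open>T\<close> to the power \<open>k + 1\<close>: the powers start at \<open>T\<close> as \<open>\<T>\<close> may lack the identity.\<close>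
  define U where "U k = (((o\<^sub>L) T) ^^ k) T" for k
  have U: "U k \<in> \<T>" for k
    by (induction k) (auto simp: U_def T compose)
  have U_Suc: "U k (T x) = U (Suc k) x" for k
    by (induction k) (auto simp: U_def)
  define n where "n = Suc (nat \<lceil>2 * M * norm x / e\<rceil>)"
  have n: "n > 0" "2 * M * norm x / e < real n"
    unfolding n_def by linarith+
  define A where "A = (\<Sum>k<n. (1 / real n) *\<^sub>R U k)"
  have "A \<in> convex hull \<T>"
    unfolding A_def by (rule convex_sum) (use U n in \<open>auto intro: hull_inc\<close>)
  moreover have "norm (A ((T - id_blinfun) x)) < e"
  proof -
    have "A ((T - id_blinfun) x) = (1 / real n) *\<^sub>R (\<Sum>k<n. U (Suc k) x - U k x)"
      by (simp add: A_def blinfun.bilinear_simps blinfun.sum_left U_Suc scaleR_sum_right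
          sum_subtractf scaleR_diff_right)
    also have "\<dots> = (1 / real n) *\<^sub>R (U n x - U 0 x)"
      by (subst sum_lessThan_telescope) (rule refl)
    finally have eq: "norm (A ((T - id_blinfun) x)) = norm (U n x - U 0 x) / real n"
      by simp
    have "norm (U n x - U 0 x) \<le> M * norm x + M * norm x"
      using norm_triangle_ineq4[of "U n x" "U 0 x"] norm_blinfun_apply_le[OF M(2)[OF U], of _ x]
      by (meson add_mono order_trans)
    also have "\<dots> < e * real n"
      using n(2) \<open>e > 0\<close> by (simp add: field_simps)
    finally show ?thesis
      unfolding eq using n(1) by (simp add: pos_divide_less_eq)
  qed
  ultimately show "\<exists>A\<in>convex hull \<T>. norm (A ((T - id_blinfun) x)) < e"
    by blast
qed

lemma (in normed_space_over) vanishing_set_contains_closed_range_span: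
  assumes "\<T> \<subseteq> bounded_operators" "abelian_semigroup \<T>"
    and M: "M > 0" "\<And>A. A \<in> convex hull \<T> \<Longrightarrow> norm A \<le> M"
  shows "closed_range_span \<T> \<subseteq> vanishing_set (convex hull \<T>)"
proof -
  have compose: "\<And>S T. S \<in> \<T> \<Longrightarrow> T \<in> \<T> \<Longrightarrow> S o\<^sub>L T \<in> \<T>"
    and commute: "\<And>S T. S \<in> \<T> \<Longrightarrow> T \<in> \<T> \<Longrightarrow> S o\<^sub>L T = T o\<^sub>L S"
    and "\<T> \<noteq> {}"
    using assms(2) by (auto simp: abelian_semigroup_def)
  have "subspace (vanishing_set (convex hull \<T>))"
  proof (rule subspace_vanishing_set)
    show "convex hull \<T> \<noteq> {}" "convex hull \<T> \<subseteq> bounded_operators"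
      using \<open>\<T> \<noteq> {}\<close> assms(1) convex_bounded_operators by (auto simp: subset_hull)
  qed (use M convex_hull_compose[OF compose] convex_hull_commute[OF commute] in auto)
  moreover have "(\<Union>T\<in>\<T>. range (blinfun_apply (T - id_blinfun))) \<subseteq> vanishing_set (convex hull \<T>)"
    using vanishing_set_contains_range[OF compose M(1) M(2)[OF hull_inc]] by blast
  ultimately have "span (\<Union>T\<in>\<T>. range (blinfun_apply (T - id_blinfun))) \<subseteq> vanishing_set (convex hull \<T>)"
    by (intro span_minimal)
  then show ?thesis
    unfolding closed_range_span_def by (intro closure_minimal closed_vanishing_set[OF M])
qed

text \<open>
  A member of the hull that makes \<open>y\<close> small maps \<open>x + y\<close> to nearly \<open>x\<close>, and it increases norms by
  at most a factor \<open>M\<close>.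
\<close>

lemma norm_common_kernel_le:
  assumes M: "\<And>A. A \<in> convex hull \<T> \<Longrightarrow> norm A \<le> M"
    and x: "x \<in> common_kernel \<T>" and y: "y \<in> vanishing_set (convex hull \<T>)"
  shows "norm x \<le> M * norm (x + y)"
proof (rule field_le_epsilon)
  fix e :: real assume "e > 0"
  then obtain A where A: "A \<in> convex hull \<T>" "norm (A y) < e"
    using y unfolding vanishing_set_def by blast
  have "A x = x"
    by (rule convex_hull_fixes_common_kernel[OF A(1) x])
  then have "x = A (x + y) - A y"
    by (simp add: blinfun.bilinear_simps)
  then have "norm x \<le> norm (A (x + y)) + norm (A y)"
    by (metis norm_triangle_ineq4)
  then show "norm x \<le> M * norm (x + y) + e"
    using norm_blinfun_apply_le[OF M[OF A(1)], of "x + y"] A(2) by linarith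
qed

section \<open>The dichotomy for bounded abelian semigroups\<close>

lemma (in normed_space_over) subspace_common_kernel:
  assumes "\<T> \<subseteq> bounded_operators"
  shows "subspace (common_kernel \<T>)"
proof (rule subspaceI)
  fix c x assume "x \<in> common_kernel \<T>"
  then show "scale c x \<in> common_kernel \<T>"
    using assms by (auto simp: common_kernel_def bounded_operators_def blinfun.bilinear_simps)
qed (auto simp: common_kernel_def blinfun.bilinear_simps algebra_simps)

lemma closed_common_kernel: "closed (common_kernel \<T>)"
proof -
  have "common_kernel \<T> = (\<Inter>T\<in>\<T>. {x. (T - id_blinfun) x = 0})"
    by (auto simp: common_kernel_def)
  then show ?thesis
    by (auto intro!: closed_INT closed_Collect_eq continuous_intros)
qed

theorem corollary4p9:
  fixes scale :: "'k::real_normed_field \<Rightarrow> 'a::banach \<Rightarrow> 'a"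
    and \<T> :: "('a \<Rightarrow>\<^sub>L 'a) set"
  assumes "normed_space_over scale"
    and "normed_space_over.hereditarily_indecomposable scale"
    and "\<T> \<subseteq> normed_space_over.bounded_operators scale"
    and "abelian_semigroup \<T>"
    and "bounded \<T>"
  shows "normed_space_over.finite_dimensional scale (common_kernel \<T>) \<or>
         normed_space_over.finite_dimensional scale (normed_space_over.closed_range_span scale \<T>)"
proof -
  interpret normed_space_over scale by fact
  obtain M where M: "M > 0" "\<And>A. A \<in> convex hull \<T> \<Longrightarrow> norm A \<le> M"
    using bounded_convex_hull[OF assms(5)] by (meson bounded_pos)
  show ?thesis
  proof (rule hereditarily_indecomposable_summands[OF assms(2)])
    show "subspace (common_kernel \<T>)" "subspace (closed_range_span \<T>)"
      using subspace_common_kernel[OF assms(3)] subspace_closure[OF subspace_span]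
      by (simp_all add: closed_range_span_def)
    show "complete (common_kernel \<T>)" "complete (closed_range_span \<T>)"
      using closed_common_kernel by (simp_all add: complete_eq_closed closed_range_span_def)
    show "M \<ge> 0"
      using M by simp
    show "norm x \<le> M * norm (x + y)" if "x \<in> common_kernel \<T>" "y \<in> closed_range_span \<T>" for x y
      using norm_common_kernel_le[OF M(2)] that
        vanishing_set_contains_closed_range_span[OF assms(3,4) M] by blast
  qed
qed

end
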